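(* Let $G$ be an instance of \textsc{Stable Matching} and let $S$ be the set of matchings produced by the Disjoint Stable Matchings algorithm described in the context on input $G$. Then $S$ is a set of pairwise edge-disjoint stable matchings of $G$ of maximum size, i.e., every set of pairwise edge-disjoint stable matchings of $G$ has at most $|S|$ members.
   Context: An instance of \textsc{Stable Matching}: a complete bipartite graph $G$ with sides $\mathcal{M}$ (men) and $\mathcal{W}$ (women), $|\mathcal{M}|=|\mathcal{W}|=n$, where each person has a strictly ordered preference list of all persons of the other side (earlier = more preferred). For a perfect matching $M$, $p_M(x)$ is the partner of $x$. A pair $(m,w)$ blocks $M$ if $w$ prefers $m$ to $p_M(w)$ and $m$ prefers $w$ to $p_M(m)$; $M$ is stable if no pair blocks it. "Deleting a pair $(m,w)$" means removing $m$ from $w$'s current list and $w$ from $m$'s current list. Extended Gale-Shapley (GS-Extended), operating on the current (modifiable) lists: all persons start free; while some man $m$ is free: let $w$ be the first woman on $m$'s current list; if some man $p$ is engaged to $w$, make $p$ free; engage $m$ and $w$; for each successor $m'$ of $m$ on $w$'s current list, delete the pair $(m',w)$. Return the set of engaged pairs. Disjoint Stable Matchings algorithm on input $G$: set $S\gets\varnothing$. Compute the woman-optimal stable matching $M_z$ of $G$ (by the woman-proposing Gale-Shapley algorithm on the original lists). Set $X\gets$ GS-Extended$(G)$ (modifying the lists). While $X\cap M_z=\varnothing$: put $S\gets S\cup\{X\}$; for every man $m$, delete the first woman $w$ on $m$'s current list (which is $m$'s partner in $X$) and delete the last man on $w$'s current list (which is $w$'s partner in $X$); then set $X\gets$ GS-Extended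 on the current lists. After the loop, put $S\gets S\cup\{M_z\}$ and return $S$. *)

theory Defs
  imports Main
begin

text \<open>
  The men and the women are the elements of two types. Preference lists are kept as a pair of
  functions, most preferred person first; the same type serves for the preference lists of an
  instance and for the shrinking lists manipulated by the algorithms. A matching is a set of
  (man, woman) pairs.
\<close>

type_synonym ('m, 'w) pref_lists = "('m \<Rightarrow> 'w list) \<times> ('w \<Rightarrow> 'm list)"

definition sm_instance :: "('m, 'w) pref_lists \<Rightarrow> bool" where
  "sm_instance I \<longleftrightarrow>
     card (UNIV :: 'm set) = card (UNIV :: 'w set) \<and>
     (\<forall>m. distinct (fst I m) \<and> set (fst I m) = UNIV) \<and>
     (\<forall>w. distinct (snd I w) \<and> set (snd I w) = UNIV)"

definition prefers :: "'a list \<Rightarrow> 'a \<Rightarrow> 'a \<Rightarrow> bool" where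
  "prefers xs x y \<longleftrightarrow> (\<exists>i j. i < j \<and> j < length xs \<and> xs ! i = x \<and> xs ! j = y)"

definition perfect_matching :: "('m \<times> 'w) set \<Rightarrow> bool" where
  "perfect_matching M \<longleftrightarrow> (\<forall>m. \<exists>!w. (m, w) \<in> M) \<and> (\<forall>w. \<exists>!m. (m, w) \<in> M)"

definition wife :: "('m \<times> 'w) set \<Rightarrow> 'm \<Rightarrow> 'w" where
  "wife M m = (THE w. (m, w) \<in> M)"

definition husband :: "('m \<times> 'w) set \<Rightarrow> 'w \<Rightarrow> 'm" where
  "husband M w = (THE m. (m, w) \<in> M)"

definition blocks :: "('m, 'w) pref_lists \<Rightarrow> ('m \<times> 'w) set \<Rightarrow> 'm \<Rightarrow> 'w \<Rightarrow> bool" where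
  "blocks I M m w \<longleftrightarrow> prefers (snd I w) m (husband M w) \<and> prefers (fst I m) w (wife M m)"

definition stable_matching :: "('m, 'w) pref_lists \<Rightarrow> ('m \<times> 'w) set \<Rightarrow> bool" where
  "stable_matching I M \<longleftrightarrow> perfect_matching M \<and> (\<nexists>m w. blocks I M m w)"

text \<open>
  The algorithms are nondeterministic (which free person acts next is left open), so they are
  given as relations between inputs and possible outputs.

  First the classical Gale-Shapley algorithm, where the first component of the instance holds the
  lists of the proposing side. A state consists of the proposals made so far and of the engaged
  pairs.
\<close>

inductive gs_step ::
  "('a, 'b) pref_lists \<Rightarrow> ('a \<times> 'b) set \<times> ('a \<times> 'b) set \<Rightarrow> ('a \<times> 'b) set \<times> ('a \<times> 'b) set \<Rightarrow> bool"
  for I where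
  accept_free:
    "\<lbrakk>a \<notin> Domain E; filter (\<lambda>y. (a, y) \<notin> Q) (fst I a) = b # bs; b \<notin> Range E\<rbrakk>
     \<Longrightarrow> gs_step I (Q, E) (insert (a, b) Q, insert (a, b) E)"
| accept_better:
    "\<lbrakk>a \<notin> Domain E; filter (\<lambda>y. (a, y) \<notin> Q) (fst I a) = b # bs; (a', b) \<in> E;
      prefers (snd I b) a a'\<rbrakk>
     \<Longrightarrow> gs_step I (Q, E) (insert (a, b) Q, insert (a, b) (E - {(a', b)}))"
| reject:
    "\<lbrakk>a \<notin> Domain E; filter (\<lambda>y. (a, y) \<notin> Q) (fst I a) = b # bs; (a', b) \<in> E;
      \<not> prefers (snd I b) a a'\<rbrakk>
     \<Longrightarrow> gs_step I (Q, E) (insert (a, b) Q, E)"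

definition gale_shapley :: "('a, 'b) pref_lists \<Rightarrow> ('a \<times> 'b) set \<Rightarrow> bool" where
  "gale_shapley I E \<longleftrightarrow> (\<exists>Q. (gs_step I)\<^sup>*\<^sup>* ({}, {}) (Q, E) \<and> Domain E = UNIV)"

definition woman_proposing_gs :: "('m, 'w) pref_lists \<Rightarrow> ('m \<times> 'w) set \<Rightarrow> bool" where
  "woman_proposing_gs I M \<longleftrightarrow> gale_shapley (snd I, fst I) (M\<inverse>)"

definition delete_pair :: "'m \<Rightarrow> 'w \<Rightarrow> ('m, 'w) pref_lists \<Rightarrow> ('m, 'w) pref_lists" where
  "delete_pair m w L =
     ((fst L)(m := removeAll w (fst L m)), (snd L)(w := removeAll m (snd L w)))"

definition successors :: "'a \<Rightarrow> 'a list \<Rightarrow> 'a list" where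
  "successors x xs = tl (dropWhile (\<lambda>y. y \<noteq> x) xs)"

inductive gs_ext_step ::
  "('m, 'w) pref_lists \<times> ('m \<times> 'w) set \<Rightarrow> ('m, 'w) pref_lists \<times> ('m \<times> 'w) set \<Rightarrow> bool" where
  "\<lbrakk>m \<notin> Domain E; fst L m = w # ws\<rbrakk>
   \<Longrightarrow> gs_ext_step (L, E)
         (fold (\<lambda>m'. delete_pair m' w) (successors m (snd L w)) L,
          insert (m, w) {(p, v) \<in> E. v \<noteq> w})"

text \<open>Started on the lists \<open>L\<close>, GS-Extended may end with the lists \<open>L'\<close> and return \<open>X\<close>.\<close>

definition gs_extended ::
  "('m, 'w) pref_lists \<Rightarrow> ('m, 'w) pref_lists \<Rightarrow> ('m \<times> 'w) set \<Rightarrow> bool" where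
  "gs_extended L L' X \<longleftrightarrow> gs_ext_step\<^sup>*\<^sup>* (L, {}) (L', X) \<and> Domain X = UNIV"

inductive trim_men ::
  "'m list \<Rightarrow> ('m, 'w) pref_lists \<Rightarrow> ('m, 'w) pref_lists \<Rightarrow> bool" where
  "trim_men [] L L"
| "\<lbrakk>fst L m = w # ws; trim_men ms ((fst L)(m := ws), (snd L)(w := butlast (snd L w))) L'\<rbrakk>
   \<Longrightarrow> trim_men (m # ms) L L'"

definition trim :: "('m, 'w) pref_lists \<Rightarrow> ('m, 'w) pref_lists \<Rightarrow> bool" where
  "trim L L' \<longleftrightarrow> (\<exists>ms. distinct ms \<and> set ms = UNIV \<and> trim_men ms L L')"

text \<open>
  The while loop, for the woman-optimal stable matching \<open>Mz\<close>: started with the current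
  lists \<open>L\<close>, the current matching \<open>X\<close> and the matchings \<open>S\<close> collected so far, it may end
  with the final collection \<open>R\<close>.
\<close>

inductive dsm_loop ::
  "('m \<times> 'w) set \<Rightarrow> ('m, 'w) pref_lists \<Rightarrow> ('m \<times> 'w) set \<Rightarrow> ('m \<times> 'w) set set \<Rightarrow>
   ('m \<times> 'w) set set \<Rightarrow> bool"
  for Mz where
  stop:
    "X \<inter> Mz \<noteq> {} \<Longrightarrow> dsm_loop Mz L X S (insert Mz S)"
| continue:
    "\<lbrakk>X \<inter> Mz = {}; trim L L'; gs_extended L' L'' X'; dsm_loop Mz L'' X' (insert X S) R\<rbrakk>
     \<Longrightarrow> dsm_loop Mz L X S R"

definition dsm_output :: "('m, 'w) pref_lists \<Rightarrow> ('m \<times> 'w) set set \<Rightarrow> bool" where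
  "dsm_output I S \<longleftrightarrow>
     (\<exists>Mz L X. woman_proposing_gs I Mz \<and> gs_extended I L X \<and> dsm_loop Mz L X {} S)"

definition disjoint_stable_family ::
  "('m, 'w) pref_lists \<Rightarrow> ('m \<times> 'w) set set \<Rightarrow> bool" where
  "disjoint_stable_family I S \<longleftrightarrow> (\<forall>M\<in>S. stable_matching I M) \<and> pairwise disjnt S"

end

(* The current lists are always the original ones restricted to a set A of surviving pairs. Each
   deletion truncates a woman's list from below, so if every man is engaged to the first woman left
   on his list, a pair he would prefer has been deleted and the woman is better off: every matching
   X found is stable in G. A stable matching contained in A survives every run of GS-Extended,
   hence X is man-optimal among those, and M_z survives as long as it is disjoint from every X found.

   Maximality: let T be a family of disjoint stable matchings inside A. Passing through T and
   replacing a pair M, N by its join and meet (which use the same edges) turns T into a top matching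
   P and a family T' of the other matchings, all strictly below P for every man. As X is at least P
   for every man, T' avoids X, so removing X from A costs at most one matching of the family. When
   X meets M_z, some man has only one stable partner left and at most one matching remains. *)

theory Submission imports Defs begin

section \<open>Preference lists and matchings\<close>

lemma prefers_iff_split:
  "prefers xs x y \<longleftrightarrow> (\<exists>us vs. xs = us @ x # vs \<and> y \<in> set vs)"
proof
  assume "prefers xs x y"
  then obtain i j where ij: "i < j" "j < length xs" "xs ! i = x" "xs ! j = y"
    unfolding prefers_def by blast
  then have "xs = take i xs @ x # drop (Suc i) xs"
    using id_take_nth_drop[of i xs] by simp
  moreover have "y \<in> set (drop (Suc i) xs)"
    using ij by (auto simp: in_set_conv_nth intro!: exI[of _ "j - Suc i"])
  ultimately show "\<exists>us vs. xs = us @ x # vs \<and> y \<in> set vs" by blast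
next
  assume "\<exists>us vs. xs = us @ x # vs \<and> y \<in> set vs"
  then obtain us vs k where "xs = us @ x # vs" "k < length vs" "vs ! k = y"
    by (auto simp: in_set_conv_nth)
  then show "prefers xs x y"
    unfolding prefers_def
    by (intro exI[of _ "length us"] exI[of _ "length us + Suc k"]) (auto simp: nth_append)
qed

lemma prefers_irrefl: "distinct xs \<Longrightarrow> \<not> prefers xs x x"
  by (auto simp: prefers_def distinct_conv_nth)

lemma prefers_trans:
  assumes "distinct xs" "prefers xs x y" "prefers xs y z"
  shows "prefers xs x z"
proof -
  from assms(2,3) obtain i j k l where
    "i < j" "j < length xs" "xs ! i = x" "xs ! j = y"
    "k < l" "l < length xs" "xs ! k = y" "xs ! l = z"
    unfolding prefers_def by blast
  moreover from this have "j = k"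
    using assms(1) by (metis nth_eq_iff_index_eq order.strict_trans)
  ultimately show ?thesis unfolding prefers_def by (metis order.strict_trans)
qed

lemma prefers_total:
  assumes "x \<in> set xs" "y \<in> set xs" "x \<noteq> y"
  shows "prefers xs x y \<or> prefers xs y x"
  using assms unfolding prefers_def in_set_conv_nth by (metis linorder_neqE_nat)

lemma filter_eq_Cons_prefers:
  assumes "filter P xs = y # ys" "z \<in> set xs" "P z"
  shows "z = y \<or> prefers xs y z"
proof -
  obtain us vs where "xs = us @ y # vs" "\<forall>u\<in>set us. \<not> P u"
    using assms(1) unfolding filter_eq_Cons_iff by blast
  then show ?thesis using assms(2,3) by (auto simp: prefers_iff_split)
qed

lemma tl_filter:
  assumes "distinct xs" "filter P xs = y # ys"
  shows "ys = filter (\<lambda>z. P z \<and> z \<noteq> y) xs"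
proof -
  have "distinct (y # ys)" using assms by (metis distinct_filter)
  then have "ys = removeAll y (filter P xs)" by (simp add: assms(2))
  then show ?thesis by (auto simp: removeAll_filter_not_eq intro!: filter_cong)
qed

text \<open>Nothing that satisfies \<open>P\<close> comes after \<open>y\<close>, so
  \<open>y\<close> ends the filtered list. With \<open>tl_filter\<close> this turns trimming a list
  at either end into removing one pair from the set of surviving pairs.\<close>

lemma butlast_filter:
  assumes "distinct xs" "y \<in> set xs" "P y" "\<And>z. z \<in> set xs \<Longrightarrow> P z \<Longrightarrow> z = y \<or> prefers xs z y"
  shows "butlast (filter P xs) = filter (\<lambda>z. P z \<and> z \<noteq> y) xs"
proof -
  obtain us vs where xs: "xs = us @ y # vs" using assms(2) by (metis split_list)
  have "\<not> P z" if "z \<in> set vs" for z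
  proof
    assume "P z"
    have "prefers xs y z" using xs that by (auto simp: prefers_iff_split)
    moreover from this have "prefers xs z y"
      using assms(1) assms(4)[of z] \<open>P z\<close> xs that by auto
    ultimately show False using assms(1) prefers_irrefl prefers_trans by metis
  qed
  then have "filter P vs = []" by simp
  then have "filter P xs = filter P us @ [y]" using xs assms(3) by simp
  moreover have "filter (\<lambda>z. P z \<and> z \<noteq> y) vs = []"
    using \<open>filter P vs = []\<close> by (simp add: filter_empty_conv)
  moreover have "filter (\<lambda>z. P z \<and> z \<noteq> y) us = filter P us"
    using assms(1) xs by (intro filter_cong) auto
  ultimately show ?thesis using xs by simp
qed

text \<open>Translates the deletions of GS-Extended from list positions to the original preference
  order; distinctness makes the split of the list at \<open>x\<close> unique.\<close>

lemma set_successors_filter: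
  assumes "distinct xs" "x \<in> set xs" "P x"
  shows "set (successors x (filter P xs)) = {y. P y \<and> prefers xs x y}"
proof -
  obtain us vs where xs: "xs = us @ x # vs" using assms(2) by (metis split_list)
  have "dropWhile (\<lambda>y. y \<noteq> x) (filter P us @ x # filter P vs) = x # filter P vs"
    using assms(1) xs by (subst dropWhile_append2) auto
  then have "set (successors x (filter P xs)) = {y \<in> set vs. P y}"
    using xs assms(3) by (simp add: successors_def)
  moreover have "prefers xs x y \<longleftrightarrow> y \<in> set vs" for y
  proof
    assume "prefers xs x y"
    then obtain us' vs' where split: "xs = us' @ x # vs'" "y \<in> set vs'"
      unfolding prefers_iff_split by blast
    have "x \<notin> set us" "x \<notin> set vs" using assms(1) xs by auto
    then have "vs = vs'" using append_Cons_eq_iff[of x us vs us' vs'] xs split(1) by simp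
    then show "y \<in> set vs" using split(2) by simp
  next
    assume "y \<in> set vs"
    then show "prefers xs x y" using xs unfolding prefers_iff_split by blast
  qed
  ultimately show ?thesis by auto
qed

section \<open>Perfect matchings and stability in relational form\<close>

lemma wife_eq: "perfect_matching M \<Longrightarrow> (m, w) \<in> M \<Longrightarrow> wife M m = w"
  unfolding wife_def perfect_matching_def by (rule the1_equality) blast+

lemma husband_eq: "perfect_matching M \<Longrightarrow> (m, w) \<in> M \<Longrightarrow> husband M w = m"
  unfolding husband_def perfect_matching_def by (rule the1_equality) blast+

text \<open>Eliminates the definite descriptions \<open>wife\<close> and \<open>husband\<close>. The
  resulting condition is first-order and treats the two sides alike, so exchanging men and women
  becomes immediate.\<close>

lemma stable_matching_iff:
  "stable_matching I M \<longleftrightarrow> perfect_matching M \<and>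
     (\<forall>m w m' w'. (m', w) \<in> M \<longrightarrow> (m, w') \<in> M \<longrightarrow>
        prefers (snd I w) m m' \<longrightarrow> \<not> prefers (fst I m) w w')"
proof (cases "perfect_matching M")
  case True
  have "blocks I M m w \<longleftrightarrow> (\<exists>m' w'. (m', w) \<in> M \<and> (m, w') \<in> M \<and>
      prefers (snd I w) m m' \<and> prefers (fst I m) w w')" for m w
  proof
    assume "blocks I M m w"
    moreover obtain m' w' where "(m', w) \<in> M" "(m, w') \<in> M"
      using True unfolding perfect_matching_def by metis
    ultimately show "\<exists>m' w'. (m', w) \<in> M \<and> (m, w') \<in> M \<and>
      prefers (snd I w) m m' \<and> prefers (fst I m) w w'"
      unfolding blocks_def using wife_eq[OF True] husband_eq[OF True] by metis
  qed (auto simp: blocks_def wife_eq[OF True] husband_eq[OF True])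
  then show ?thesis using True unfolding stable_matching_def by blast
qed (simp add: stable_matching_def)

lemma stable_perfect: "stable_matching I M \<Longrightarrow> perfect_matching M"
  by (simp add: stable_matching_def)

lemma not_blocked:
  "stable_matching I M \<Longrightarrow> (m', w) \<in> M \<Longrightarrow> (m, w') \<in> M \<Longrightarrow>
    prefers (snd I w) m m' \<Longrightarrow> \<not> prefers (fst I m) w w'"
  unfolding stable_matching_iff by blast

lemma perfect_unique:
  assumes "perfect_matching M"
  shows "(m, w) \<in> M \<Longrightarrow> (m, w') \<in> M \<Longrightarrow> w = w'" "(m, w) \<in> M \<Longrightarrow> (m', w) \<in> M \<Longrightarrow> m = m'"
  using assms unfolding perfect_matching_def by blast+

lemma perfect_partner:
  assumes "perfect_matching M"
  obtains w where "(m, w) \<in> M"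
  using assms unfolding perfect_matching_def by blast

lemma perfect_partner':
  assumes "perfect_matching M"
  obtains m where "(m, w) \<in> M"
  using assms unfolding perfect_matching_def by blast

lemma perfect_matching_converse: "perfect_matching (M\<inverse>) \<longleftrightarrow> perfect_matching M"
  unfolding perfect_matching_def by auto

lemma stable_matching_converse:
  "stable_matching (snd I, fst I) (M\<inverse>) \<longleftrightarrow> stable_matching I M"
  unfolding stable_matching_iff perfect_matching_converse by auto

text \<open>An injection between finite types of equal size is onto, so the women are covered once
  every man is.\<close>

lemma perfect_matching_if_inj:
  fixes M :: "('m::finite \<times> 'w::finite) set"
  assumes card: "card (UNIV :: 'm set) = card (UNIV :: 'w set)"
    and dom: "Domain M = UNIV"
    and fn: "\<And>m w w'. (m, w) \<in> M \<Longrightarrow> (m, w') \<in> M \<Longrightarrow> w = w'"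
    and inj: "\<And>m m' w. (m, w) \<in> M \<Longrightarrow> (m', w) \<in> M \<Longrightarrow> m = m'"
  shows "perfect_matching M"
proof -
  have "\<forall>m. \<exists>w. (m, w) \<in> M" using dom by blast
  then obtain f where f: "\<And>m. (m, f m) \<in> M" by metis
  then have "inj f" using inj by (metis injI)
  then have "card (range f) = card (UNIV :: 'w set)" using card by (simp add: card_image)
  then have "surj f" by (intro card_subset_eq) auto
  then have "\<exists>m. (m, w) \<in> M" for w using f by (metis surjD)
  then show ?thesis unfolding perfect_matching_def using f fn inj by metis
qed

section \<open>GS-Extended\<close>

text \<open>One set of pairs for both sides ensures that a man is on a woman's list exactly when she
  is on his, and it makes every deletion a set difference.\<close>

definition restrict_lists ::
  "('m, 'w) pref_lists \<Rightarrow> ('m \<times> 'w) set \<Rightarrow> ('m, 'w) pref_lists" where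
  "restrict_lists I A =
     (\<lambda>m. filter (\<lambda>w. (m, w) \<in> A) (fst I m), \<lambda>w. filter (\<lambda>m. (m, w) \<in> A) (snd I w))"

lemma restrict_lists_UNIV: "restrict_lists I UNIV = I"
  by (simp add: restrict_lists_def)

lemma delete_pair_restrict:
  "delete_pair m w (restrict_lists I A) = restrict_lists I (A - {(m, w)})"
  by (auto simp: delete_pair_def restrict_lists_def removeAll_filter_not_eq fun_eq_iff
      intro!: filter_cong)

lemma fold_delete_pair_restrict:
  "fold (\<lambda>m. delete_pair m w) ms (restrict_lists I A) = restrict_lists I (A - set ms \<times> {w})"
proof (induction ms arbitrary: A)
  case (Cons m ms)
  have "A - {(m, w)} - set ms \<times> {w} = A - set (m # ms) \<times> {w}" by auto
  then show ?case using Cons by (simp add: delete_pair_restrict)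
qed simp

text \<open>The form in which the woman-optimality of \<open>Mz\<close> enters the analysis of the
  loop, stated on the men's side.\<close>

definition man_pessimal :: "('m, 'w) pref_lists \<Rightarrow> ('m \<times> 'w) set \<Rightarrow> bool" where
  "man_pessimal I Z \<longleftrightarrow> stable_matching I Z \<and>
     (\<forall>M m w w'. stable_matching I M \<longrightarrow> (m, w) \<in> Z \<longrightarrow> (m, w') \<in> M \<longrightarrow> w' = w \<or> prefers (fst I m) w' w)"

context
  fixes I :: "('m::finite, 'w::finite) pref_lists"
  assumes inst: "sm_instance I"
begin

abbreviation mpref where "mpref m \<equiv> prefers (fst I m)"
abbreviation wpref where "wpref w \<equiv> prefers (snd I w)"

lemma card_eq: "card (UNIV :: 'm set) = card (UNIV :: 'w set)"
  using inst by (simp add: sm_instance_def)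

lemma inst_lists:
  "distinct (fst I m)" "set (fst I m) = UNIV" "distinct (snd I w)" "set (snd I w) = UNIV"
  using inst by (auto simp: sm_instance_def)

lemma mpref_irrefl: "\<not> mpref m w w" and wpref_irrefl: "\<not> wpref w m m"
  by (simp_all add: prefers_irrefl inst_lists)

lemma mpref_trans: "mpref m x y \<Longrightarrow> mpref m y z \<Longrightarrow> mpref m x z"
  and wpref_trans: "wpref w a b \<Longrightarrow> wpref w b c \<Longrightarrow> wpref w a c"
  using prefers_trans inst_lists by metis+

lemma mpref_total: "x \<noteq> y \<Longrightarrow> mpref m x y \<or> mpref m y x"
  and wpref_total: "a \<noteq> b \<Longrightarrow> wpref w a b \<or> wpref w b a"
  using prefers_total inst_lists by (metis UNIV_I)+

lemma mpref_asym: "mpref m x y \<Longrightarrow> \<not> mpref m y x" and wpref_asym: "wpref w a b \<Longrightarrow> \<not> wpref w b a"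
  using mpref_trans mpref_irrefl wpref_trans wpref_irrefl by metis+

text \<open>The invariant of GS-Extended: the women's lists, described by the set \<open>A\<close> of pairs not yet
  deleted, are prefixes of the original ones, and every engaged pair consists of the first woman
  and the last man on each other's current lists.\<close>

definition gs_ext_inv :: "('m \<times> 'w) set \<Rightarrow> ('m \<times> 'w) set \<Rightarrow> bool" where
  "gs_ext_inv A E \<longleftrightarrow>
     (\<forall>m m' w. (m', w) \<in> A \<longrightarrow> wpref w m m' \<longrightarrow> (m, w) \<in> A) \<and> E \<subseteq> A \<and>
     (\<forall>m w w'. (m, w) \<in> E \<longrightarrow> (m, w') \<in> A \<longrightarrow> w' = w \<or> mpref m w w') \<and>
     (\<forall>m m' w. (m, w) \<in> E \<longrightarrow> (m', w) \<in> A \<longrightarrow> m' = m \<or> wpref w m' m)"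

lemma gs_ext_invD:
  assumes "gs_ext_inv A E"
  shows "(m', w) \<in> A \<Longrightarrow> wpref w m m' \<Longrightarrow> (m, w) \<in> A" "E \<subseteq> A"
    "(m, w) \<in> E \<Longrightarrow> (m, w') \<in> A \<Longrightarrow> w' = w \<or> mpref m w w'"
    "(m, w) \<in> E \<Longrightarrow> (m', w) \<in> A \<Longrightarrow> m' = m \<or> wpref w m' m"
  using assms unfolding gs_ext_inv_def by blast+

lemma gs_ext_inv_fun: "gs_ext_inv A E \<Longrightarrow> (m, w) \<in> E \<Longrightarrow> (m, w') \<in> E \<Longrightarrow> w = w'"
  by (metis gs_ext_invD(2,3) mpref_asym subsetD)

lemma gs_ext_inv_inj: "gs_ext_inv A E \<Longrightarrow> (m, w) \<in> E \<Longrightarrow> (m', w) \<in> E \<Longrightarrow> m = m'"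
  by (metis gs_ext_invD(2,4) wpref_asym subsetD)

text \<open>If \<open>w\<close> prefers \<open>m\<close> to her partner, then \<open>(m, w)\<close>
  is still in \<open>A\<close> because her list is a prefix. But the partner of \<open>m\<close>
  heads his list in \<open>A\<close>, so he does not prefer \<open>w\<close>.\<close>

lemma gs_ext_inv_stable:
  assumes "gs_ext_inv A X" "Domain X = UNIV"
  shows "stable_matching I X"
proof -
  have "perfect_matching X"
    using card_eq assms(2) gs_ext_inv_fun[OF assms(1)] gs_ext_inv_inj[OF assms(1)]
    by (rule perfect_matching_if_inj)
  moreover have False
    if "(m', w) \<in> X" "(m, w') \<in> X" "wpref w m m'" "mpref m w w'" for m m' w w'
    using that gs_ext_invD[OF assms(1)] by (metis mpref_asym mpref_irrefl subsetD)
  ultimately show ?thesis unfolding stable_matching_iff by blast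
qed

text \<open>All that is used about a single step. The measure in the last claim drops because either
  a free woman becomes engaged, or the number of engagements stays the same and the pair of the
  displaced man leaves \<open>A\<close>.\<close>

lemma gs_ext_step_restrict:
  assumes "gs_ext_inv A E" "m \<notin> Domain E" "fst (restrict_lists I A) m = w # ws"
  defines "A' \<equiv> A - {m'. wpref w m m'} \<times> {w}"
    and "E' \<equiv> insert (m, w) {(p, v) \<in> E. v \<noteq> w}"
  shows "fold (\<lambda>m'. delete_pair m' w) (successors m (snd (restrict_lists I A) w)) (restrict_lists I A)
      = restrict_lists I A'"
    and "gs_ext_inv A' E'"
    and "stable_matching I M \<Longrightarrow> M \<subseteq> A \<Longrightarrow> M \<subseteq> A'"
    and "card A' + (card (UNIV :: ('m \<times> 'w) set) - card E') <
         card A + (card (UNIV :: ('m \<times> 'w) set) - card E)"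
proof -
  have fl: "filter (\<lambda>w. (m, w) \<in> A) (fst I m) = w # ws"
    using assms(3) by (simp add: restrict_lists_def)
  then have "w \<in> set (filter (\<lambda>w. (m, w) \<in> A) (fst I m))" by simp
  then have mw: "(m, w) \<in> A" by simp
  have top: "w' = w \<or> mpref m w w'" if "(m, w') \<in> A" for w'
    using filter_eq_Cons_prefers[OF fl] that inst_lists by auto
  have "set (successors m (snd (restrict_lists I A) w)) = {m'. (m', w) \<in> A \<and> wpref w m m'}"
    using mw by (auto simp: restrict_lists_def set_successors_filter inst_lists)
  then have "A - set (successors m (snd (restrict_lists I A) w)) \<times> {w} = A'"
    by (auto simp: A'_def)
  then show "fold (\<lambda>m'. delete_pair m' w) (successors m (snd (restrict_lists I A) w))
      (restrict_lists I A) = restrict_lists I A'"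
    by (simp add: fold_delete_pair_restrict)
  note inv = gs_ext_invD[OF assms(1)]
  \<comment> \<open>A man engaged to \<open>w\<close> is last on her list and differs from the free
    man \<open>m\<close>, so he is among the successors to be deleted.\<close>
  have freed: "wpref w m p" if "(p, w) \<in> E" for p
    using inv(4)[OF that mw] that assms(2) by blast
  show "gs_ext_inv A' E'"
    unfolding gs_ext_inv_def
  proof (intro conjI allI impI)
    show "E' \<subseteq> A'" using inv(2) mw wpref_irrefl by (auto simp: E'_def A'_def)
  next
    fix a b c assume "(b, c) \<in> A'" "wpref c a b"
    then show "(a, c) \<in> A'" using inv(1)[of b c a] by (auto simp: A'_def dest: wpref_trans)
  next
    fix a b c assume "(a, b) \<in> E'" "(a, c) \<in> A'"
    then show "c = b \<or> mpref a b c" using inv(3)[of a b c] top by (auto simp: E'_def A'_def)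
  next
    fix a b c assume "(a, c) \<in> E'" "(b, c) \<in> A'"
    then show "b = a \<or> wpref c b a"
      using inv(4)[of a c b] wpref_total[of b m w] by (auto simp: E'_def A'_def)
  qed
  show "M \<subseteq> A'" if M: "stable_matching I M" "M \<subseteq> A"
  proof -
    \<comment> \<open>Otherwise \<open>(m, w)\<close> blocks \<open>M\<close>: the partner of
      \<open>m\<close> in \<open>M\<close> is on his current list, which \<open>w\<close>
      heads.\<close>
    have "\<not> wpref w m m'" if "(m', w) \<in> M" for m'
    proof
      assume wpref: "wpref w m m'"
      obtain w' where w': "(m, w') \<in> M"
        using stable_perfect[OF M(1)] unfolding perfect_matching_def by blast
      have "w' \<noteq> w" using w' that wpref stable_perfect[OF M(1)] wpref_irrefl
        unfolding perfect_matching_def by blast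
      then have "mpref m w w'" using top w' M(2) by blast
      then show False using not_blocked[OF M(1) that w' wpref] by blast
    qed
    then show ?thesis using M(2) by (auto simp: A'_def)
  qed
  have le: "card F \<le> card (UNIV :: ('m \<times> 'w) set)" for F :: "('m \<times> 'w) set"
    by (intro card_mono) auto
  have notin: "(m, w) \<notin> {(p, v) \<in> E. v \<noteq> w}" by auto
  show "card A' + (card (UNIV :: ('m \<times> 'w) set) - card E') <
         card A + (card (UNIV :: ('m \<times> 'w) set) - card E)"
  proof (cases "w \<in> Range E")
    case True
    then obtain p where p: "(p, w) \<in> E" by blast
    then have "{(p, v) \<in> E. v \<noteq> w} = E - {(p, w)}"
      using gs_ext_inv_inj[OF assms(1)] by auto
    then have "card E' = card E" using notin p card.remove[of E "(p, w)"]
      by (simp add: E'_def)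
    moreover have "A' \<subset> A" using p inv(2) freed by (auto simp: A'_def)
    then have "card A' < card A" by (intro psubset_card_mono) auto
    ultimately show ?thesis by simp
  next
    case False
    then have "{(p, v) \<in> E. v \<noteq> w} = E" by auto
    then have "card E' = Suc (card E)" using notin by (simp add: E'_def)
    moreover have "card A' \<le> card A" by (intro card_mono) (auto simp: A'_def)
    ultimately show ?thesis using le[of E'] by linarith
  qed
qed

section \<open>Complete runs of GS-Extended\<close>

lemma gs_ext_run:
  assumes "gs_ext_step\<^sup>*\<^sup>* (L, E) (L', E')" "L = restrict_lists I A" "gs_ext_inv A E"
  shows "\<exists>A' \<subseteq> A. L' = restrict_lists I A' \<and> gs_ext_inv A' E' \<and>
           (\<forall>M. stable_matching I M \<longrightarrow> M \<subseteq> A \<longrightarrow> M \<subseteq> A')"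
  using assms
proof (induction rule: rtranclp_induct2)
  case (step L1 E1 L2 E2)
  then obtain A1 where A1: "A1 \<subseteq> A" "L1 = restrict_lists I A1" "gs_ext_inv A1 E1"
      "\<forall>M. stable_matching I M \<longrightarrow> M \<subseteq> A \<longrightarrow> M \<subseteq> A1"
    by blast
  from step.hyps(2) obtain m w ws where s: "m \<notin> Domain E1" "fst L1 m = w # ws"
      "L2 = fold (\<lambda>m'. delete_pair m' w) (successors m (snd L1 w)) L1"
      "E2 = insert (m, w) {(p, v) \<in> E1. v \<noteq> w}"
    by (auto elim: gs_ext_step.cases)
  note r = gs_ext_step_restrict[OF A1(3) s(1) s(2)[unfolded A1(2)]]
  show ?case
    using A1 s r(1-3) by (intro exI[of _ "A1 - {m'. wpref w m m'} \<times> {w}"]) auto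
qed auto

lemma gs_extendedD:
  assumes "gs_extended (restrict_lists I A) L' X" "gs_ext_inv A {}"
  obtains A' where "A' \<subseteq> A" "L' = restrict_lists I A'" "gs_ext_inv A' X" "Domain X = UNIV"
    "\<And>M. stable_matching I M \<Longrightarrow> M \<subseteq> A \<Longrightarrow> M \<subseteq> A'"
  using gs_ext_run[OF _ refl assms(2)] assms(1) unfolding gs_extended_def by metis

text \<open>A stable matching inside \<open>A\<close> survives all deletions, so a free man never
  faces an empty list and the run can only stop with every man engaged.\<close>

lemma gs_ext_terminates:
  assumes "gs_ext_inv A E" "stable_matching I M" "M \<subseteq> A"
  shows "\<exists>L' X. gs_ext_step\<^sup>*\<^sup>* (restrict_lists I A, E) (L', X) \<and> Domain X = UNIV"
  using assms
proof (induction "card A + (card (UNIV :: ('m \<times> 'w) set) - card E)"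
    arbitrary: A E rule: less_induct)
  case less
  show ?case
  proof (cases "Domain E = UNIV")
    case False
    then obtain m where m: "m \<notin> Domain E" by blast
    obtain w where "(m, w) \<in> A"
      using less.prems(2,3) stable_perfect unfolding perfect_matching_def by blast
    then have "w \<in> set (fst (restrict_lists I A) m)"
      by (simp add: restrict_lists_def inst_lists)
    then obtain v vs where v: "fst (restrict_lists I A) m = v # vs"
      by (cases "fst (restrict_lists I A) m") auto
    note r = gs_ext_step_restrict[OF less.prems(1) m v]
    have "gs_ext_step (restrict_lists I A, E) (restrict_lists I (A - {m'. wpref v m m'} \<times> {v}),
        insert (m, v) {(p, u) \<in> E. u \<noteq> v})"
      using gs_ext_step.intros[OF m v] r(1) by simp
    then show ?thesis
      using less.hyps[OF r(4,2) less.prems(2) r(3)[OF less.prems(2,3)]]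
      by (meson converse_rtranclp_into_rtranclp)
  qed blast
qed

text \<open>Here \<open>E\<close> holds the engaged pairs not yet trimmed. Removing
  \<open>(m, w)\<close> from both \<open>A\<close> and \<open>E\<close> preserves the invariant, so
  the entries cut off next are again engaged partners. The equivalence yields both existence and
  uniqueness of the result.\<close>

lemma trim_men_restrict:
  assumes "gs_ext_inv A E" "set ms \<subseteq> Domain E" "distinct ms"
  shows "trim_men ms (restrict_lists I A) L' \<longleftrightarrow>
     L' = restrict_lists I (A - {(m, w) \<in> E. m \<in> set ms})"
  using assms
proof (induction ms arbitrary: A E)
  case Nil
  show ?case by (subst trim_men.simps) auto
next
  case (Cons m ms)
  note inv = gs_ext_invD[OF Cons.prems(1)]
  obtain w where w: "(m, w) \<in> E" using Cons.prems(2) by auto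
  then have wA: "(m, w) \<in> A" using inv(2) by blast
  then have "w \<in> set (filter (\<lambda>w. (m, w) \<in> A) (fst I m))"
    by (simp add: inst_lists)
  then obtain v vs where v: "filter (\<lambda>w. (m, w) \<in> A) (fst I m) = v # vs"
    by (metis list.set_cases)
  \<comment> \<open>The invariant ranks the engaged woman \<open>w\<close> above all others left on
    the list, so she is its head.\<close>
  have "v = w"
  proof -
    have "v \<in> set (filter (\<lambda>w. (m, w) \<in> A) (fst I m))" by (simp add: v)
    then have "(m, v) \<in> A" by simp
    moreover have "w = v \<or> mpref m v w"
      using filter_eq_Cons_prefers[OF v] wA inst_lists by auto
    ultimately show ?thesis using inv(3)[OF w] mpref_asym by blast
  qed
  have vs: "vs = filter (\<lambda>w'. (m, w') \<in> A \<and> w' \<noteq> w) (fst I m)"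
    using tl_filter[OF _ v] \<open>v = w\<close> inst_lists by simp
  have bl: "butlast (filter (\<lambda>m. (m, w) \<in> A) (snd I w)) =
      filter (\<lambda>m'. (m', w) \<in> A \<and> m' \<noteq> m) (snd I w)"
    using butlast_filter[of "snd I w" m "\<lambda>m. (m, w) \<in> A"] inv(4)[OF w] wA inst_lists by auto
  have upd: "((fst (restrict_lists I A))(m := vs),
      (snd (restrict_lists I A))(w := butlast (snd (restrict_lists I A) w))) =
      restrict_lists I (A - {(m, w)})"
    by (auto simp: restrict_lists_def fun_eq_iff vs bl intro!: filter_cong)
  have step: "trim_men (m # ms) (restrict_lists I A) L' \<longleftrightarrow>
      trim_men ms (restrict_lists I (A - {(m, w)})) L'"
    using v \<open>v = w\<close> upd by (subst trim_men.simps) (auto simp: restrict_lists_def)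
  have "gs_ext_inv (A - {(m, w)}) (E - {(m, w)})"
    unfolding gs_ext_inv_def
  proof (intro conjI allI impI)
    \<comment> \<open>As \<open>m\<close> was last on the list of \<open>w\<close>, no man ranked
      below him remains there, so deleting him leaves a prefix.\<close>
    fix a b c assume "(b, c) \<in> A - {(m, w)}" "wpref c a b"
    then show "(a, c) \<in> A - {(m, w)}"
      using inv(1)[of b c a] inv(4)[OF w, of b] wpref_asym[of w] by auto
  qed (use inv(2-4) in auto)
  moreover have "set ms \<subseteq> Domain (E - {(m, w)})" using Cons.prems(2,3) by auto
  moreover have "{(a, b) \<in> E. a \<in> set (m # ms)} =
      insert (m, w) {(a, b) \<in> E - {(m, w)}. a \<in> set ms}"
    using w by (auto dest: gs_ext_inv_fun[OF Cons.prems(1) w])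
  then have "A - {(m, w)} - {(a, b) \<in> E - {(m, w)}. a \<in> set ms} =
      A - {(a, b) \<in> E. a \<in> set (m # ms)}"
    by blast
  ultimately show ?case using Cons.IH[of "A - {(m, w)}" "E - {(m, w)}"] Cons.prems(3) step
    by simp
qed

text \<open>The outcome does not depend on the order in which the men are processed.\<close>

lemma trim_restrict:
  assumes "gs_ext_inv A X" "Domain X = UNIV"
  shows "trim (restrict_lists I A) L' \<longleftrightarrow> L' = restrict_lists I (A - X)"
proof -
  obtain ms :: "'m list" where "distinct ms" "set ms = UNIV"
    using finite_distinct_list[of "UNIV :: 'm set"] by auto
  moreover have "trim_men ms (restrict_lists I A) L' \<longleftrightarrow> L' = restrict_lists I (A - X)"
    if "distinct ms" "set ms = UNIV" for ms
    using trim_men_restrict[OF assms(1) _ that(1), of L'] that(2) assms(2) by simp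
  ultimately show ?thesis unfolding trim_def by blast
qed

text \<open>Every woman engaged in \<open>X\<close> loses only the last man on her list, so prefixes
  remain and the next round can start with everybody free.\<close>

lemma gs_ext_inv_remove:
  assumes "gs_ext_inv A X" "Domain X = UNIV"
  shows "gs_ext_inv (A - X) {}"
proof -
  have "(m, w) \<in> A - X" if "(m', w) \<in> A - X" "wpref w m m'" for m m' w
    using that gs_ext_invD[OF assms(1)] by (metis DiffE DiffI wpref_asym wpref_irrefl)
  then show ?thesis unfolding gs_ext_inv_def by blast
qed

section \<open>The lattice of stable matchings\<close>

text \<open>For stable \<open>M\<close> and \<open>N\<close>, this and \<open>meet\<close> below are
  the operations of the lattice of stable matchings ordered by the men's preferences. Choosing from
  \<open>M \<union> N\<close> treats a partner common to both like any other.\<close>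

definition join :: "('m \<times> 'w) set \<Rightarrow> ('m \<times> 'w) set \<Rightarrow> ('m \<times> 'w) set" where
  "join M N = {(m, w) \<in> M \<union> N. \<forall>w'. (m, w') \<in> M \<union> N \<longrightarrow> w' = w \<or> mpref m w w'}"

definition meet :: "('m \<times> 'w) set \<Rightarrow> ('m \<times> 'w) set \<Rightarrow> ('m \<times> 'w) set" where
  "meet M N = {(m, w) \<in> M \<union> N. \<forall>w'. (m, w') \<in> M \<union> N \<longrightarrow> w' = w \<or> mpref m w' w}"

lemma meet_commute: "meet M N = meet N M"
  unfolding meet_def by (simp add: Un_commute)

lemma join_fun: "(m, w) \<in> join M N \<Longrightarrow> (m, w') \<in> join M N \<Longrightarrow> w = w'"
  and meet_fun: "(m, w) \<in> meet M N \<Longrightarrow> (m, w') \<in> meet M N \<Longrightarrow> w = w'"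
  unfolding join_def meet_def using mpref_asym by blast+

lemma join_ge: "(m, w) \<in> join M N \<Longrightarrow> (m, w') \<in> M \<union> N \<Longrightarrow> w' = w \<or> mpref m w w'"
  and meet_le: "(m, w) \<in> meet M N \<Longrightarrow> (m, w') \<in> M \<union> N \<Longrightarrow> w' = w \<or> mpref m w' w"
  unfolding join_def meet_def by blast+

lemma join_subset: "join M N \<subseteq> M \<union> N" and meet_subset: "meet M N \<subseteq> M \<union> N"
  unfolding join_def meet_def by blast+

lemma join_or_meet:
  assumes "perfect_matching M" "perfect_matching N"
  shows "\<exists>w w'. (m, w) \<in> join M N \<and> (m, w') \<in> meet M N"
    and "(m, w) \<in> M \<union> N \<Longrightarrow> (m, w) \<in> join M N \<or> (m, w) \<in> meet M N"
proof -
  obtain x y where x: "(m, x) \<in> M" and y: "(m, y) \<in> N"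
    using perfect_partner[OF assms(1)] perfect_partner[OF assms(2)] by metis
  have only: "w = x \<or> w = y" if "(m, w) \<in> M \<union> N" for w
    using that x y perfect_unique(1)[OF assms(1)] perfect_unique(1)[OF assms(2)] by blast
  consider "x = y" | "mpref m x y" | "mpref m y x" using mpref_total by blast
  then have "((m, x) \<in> join M N \<and> (m, y) \<in> meet M N) \<or>
      ((m, y) \<in> join M N \<and> (m, x) \<in> meet M N)"
    unfolding join_def meet_def using x y only by cases blast+
  then show "\<exists>w w'. (m, w) \<in> join M N \<and> (m, w') \<in> meet M N"
    and "(m, w) \<in> M \<union> N \<Longrightarrow> (m, w) \<in> join M N \<or> (m, w) \<in> meet M N"
    using only by blast+
qed

lemma join_meet_eq:
  assumes "perfect_matching M" "perfect_matching N" "(m, w) \<in> join M N" "(m, w) \<in> meet M N"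
  shows "(m, w) \<in> M \<inter> N"
proof -
  have only: "w' = w" if "(m, w') \<in> M \<union> N" for w'
    using join_ge[OF assms(3) that] meet_le[OF assms(4) that] mpref_asym by blast
  obtain x y where "(m, x) \<in> M" "(m, y) \<in> N"
    using perfect_partner[OF assms(1)] perfect_partner[OF assms(2)] by metis
  then show ?thesis using only by blast
qed

text \<open>If \<open>m\<close> and \<open>m'\<close> both obtain \<open>w\<close> in the join, each
  strictly prefers her to his partner in the other matching. Whichever of them \<open>w\<close>
  prefers would block the matching that pairs her with the other.\<close>

lemma join_aux:
  assumes "stable_matching I M" "stable_matching I N"
    "(m, w) \<in> join M N" "(m', w) \<in> join M N" "(m, w) \<in> M" "(m', w) \<in> N"
  shows "m = m'"
proof (rule ccontr)
  assume ne: "m \<noteq> m'"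
  note pM = stable_perfect[OF assms(1)] and pN = stable_perfect[OF assms(2)]
  obtain x y where x: "(m', x) \<in> M" and y: "(m, y) \<in> N"
    using perfect_partner[OF pM] perfect_partner[OF pN] by metis
  have "y \<noteq> w" "x \<noteq> w"
    using ne x y assms(5,6) perfect_unique(2)[OF pM] perfect_unique(2)[OF pN] by blast+
  then have "mpref m w y" "mpref m' w x" using join_ge assms(3,4) x y by blast+
  then have "\<not> wpref w m m'" "\<not> wpref w m' m"
    using not_blocked[OF assms(2) assms(6) y] not_blocked[OF assms(1) assms(5) x] by blast+
  then show False using wpref_total ne by blast
qed

lemma join_inj:
  assumes "stable_matching I M" "stable_matching I N"
    "(m, w) \<in> join M N" "(m', w) \<in> join M N"
  shows "m = m'"
proof -
  consider "(m, w) \<in> M" "(m', w) \<in> M" | "(m, w) \<in> N" "(m', w) \<in> N"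
    | "(m, w) \<in> M" "(m', w) \<in> N" | "(m', w) \<in> M" "(m, w) \<in> N"
    using assms(3,4) join_subset by blast
  then show ?thesis
  proof cases
    case 1
    then show ?thesis by (rule perfect_unique(2)[OF stable_perfect[OF assms(1)]])
  next
    case 2
    then show ?thesis by (rule perfect_unique(2)[OF stable_perfect[OF assms(2)]])
  next
    case 3
    then show ?thesis by (rule join_aux[OF assms])
  next
    case 4
    then show ?thesis by (rule join_aux[OF assms(1,2,4,3), symmetric])
  qed
qed

lemma join_perfect:
  assumes "stable_matching I M" "stable_matching I N"
  shows "perfect_matching (join M N)"
  using card_eq _ join_fun join_inj[OF assms]
proof (rule perfect_matching_if_inj)
  show "Domain (join M N) = UNIV"
    using join_or_meet(1)[OF assms[THEN stable_perfect]] by blast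
qed

text \<open>A man who prefers \<open>w\<close> to his join partner prefers her to both of his
  partners. The join partner of \<open>w\<close> comes from \<open>M\<close> or \<open>N\<close>,
  and that matching would be blocked.\<close>

lemma join_stable:
  assumes "stable_matching I M" "stable_matching I N"
  shows "stable_matching I (join M N)"
proof -
  have False if "(m', w) \<in> join M N" "(m, w') \<in> join M N" "wpref w m m'" "mpref m w w'" for m w m' w'
  proof -
    obtain x y where x: "(m, x) \<in> M" and y: "(m, y) \<in> N"
      using assms[THEN stable_perfect] perfect_partner by metis
    have "mpref m w x" "mpref m w y"
      using join_ge[OF that(2)] x y that(4) mpref_trans by blast+
    then show False
      using join_subset[of M N] that(1,3) not_blocked[OF assms(1) _ x] not_blocked[OF assms(2) _ y]
      by blast
  qed
  then show ?thesis using join_perfect[OF assms] unfolding stable_matching_iff by blast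
qed

text \<open>The join is perfect, so it gives \<open>w\<close> to one of \<open>m\<close> and
  \<open>m'\<close>. That man has \<open>w\<close> in join and meet alike, so this pair lies in both
  \<open>M\<close> and \<open>N\<close>, which forces \<open>m = m'\<close>.\<close>

lemma meet_aux:
  assumes "stable_matching I M" "stable_matching I N"
    "(m, w) \<in> meet M N" "(m', w) \<in> meet M N" "(m, w) \<in> M" "(m', w) \<in> N"
  shows "m = m'"
proof -
  note pM = stable_perfect[OF assms(1)] and pN = stable_perfect[OF assms(2)]
  obtain a where a: "(a, w) \<in> join M N"
    using perfect_partner'[OF join_perfect[OF assms(1,2)]] .
  then have "a = m \<or> a = m'"
    using join_subset[of M N] assms(5,6) perfect_unique(2)[OF pM] perfect_unique(2)[OF pN] by blast
  then have "(m, w) \<in> M \<inter> N \<or> (m', w) \<in> M \<inter> N"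
    using join_meet_eq[OF pM pN] a assms(3,4) by blast
  then show ?thesis
    using assms(5,6) perfect_unique(2)[OF pM] perfect_unique(2)[OF pN] by blast
qed

lemma meet_inj:
  assumes "stable_matching I M" "stable_matching I N"
    "(m, w) \<in> meet M N" "(m', w) \<in> meet M N"
  shows "m = m'"
proof -
  consider "(m, w) \<in> M" "(m', w) \<in> M" | "(m, w) \<in> N" "(m', w) \<in> N"
    | "(m, w) \<in> M" "(m', w) \<in> N" | "(m', w) \<in> M" "(m, w) \<in> N"
    using assms(3,4) meet_subset by blast
  then show ?thesis
  proof cases
    case 1
    then show ?thesis by (rule perfect_unique(2)[OF stable_perfect[OF assms(1)]])
  next
    case 2
    then show ?thesis by (rule perfect_unique(2)[OF stable_perfect[OF assms(2)]])
  next
    case 3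
    then show ?thesis by (rule meet_aux[OF assms])
  next
    case 4
    then show ?thesis by (rule meet_aux[OF assms(1,2,4,3), symmetric])
  qed
qed

lemma meet_perfect:
  assumes "stable_matching I M" "stable_matching I N"
  shows "perfect_matching (meet M N)"
  using card_eq _ meet_fun meet_inj[OF assms]
proof (rule perfect_matching_if_inj)
  show "Domain (meet M N) = UNIV"
    using join_or_meet(1)[OF assms[THEN stable_perfect]] by blast
qed

text \<open>Let \<open>a\<close> be the partner of \<open>w\<close> in \<open>N\<close>. Stability
  of \<open>N\<close> makes \<open>a\<close> at least as good for \<open>w\<close> as
  \<open>m\<close>, hence better than \<open>m'\<close>; stability of \<open>M\<close> forbids
  exactly that. The case of \<open>(m, w')\<close> in \<open>M\<close> is symmetric.\<close>

lemma meet_stable_aux: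
  assumes "stable_matching I M" "stable_matching I N"
    "(m', w) \<in> meet M N" "(m, w') \<in> meet M N" "(m, w') \<in> N" "wpref w m m'" "mpref m w w'"
  shows False
proof -
  note pM = stable_perfect[OF assms(1)] and pN = stable_perfect[OF assms(2)]
  have notN: "(m', w) \<notin> N" using not_blocked[OF assms(2) _ assms(5,6)] assms(7) by blast
  then have m'M: "(m', w) \<in> M" using assms(3) meet_subset by blast
  obtain a where a: "(a, w) \<in> N" using perfect_partner'[OF pN] .
  \<comment> \<open>The meet already assigns \<open>w\<close> to \<open>m'\<close>, who is not
    \<open>a\<close>, so the edge of \<open>a\<close> must belong to the join.\<close>
  have "(a, w) \<in> join M N"
  proof (rule ccontr)
    assume "(a, w) \<notin> join M N"
    then have "(a, w) \<in> meet M N" using join_or_meet(2)[OF pM pN] a by blast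
    then show False using meet_inj[OF assms(1,2,3)] a notN by blast
  qed
  obtain x where x: "(a, x) \<in> M" using perfect_partner[OF pM] .
  have "x \<noteq> w" using x m'M a notN perfect_unique(2)[OF pM] by blast
  then have "mpref a w x" using join_ge[OF \<open>(a, w) \<in> join M N\<close>] x by blast
  then have "\<not> wpref w a m'" using not_blocked[OF assms(1) m'M x] by blast
  moreover have "a = m \<or> wpref w a m"
    using not_blocked[OF assms(2) a assms(5)] assms(7) wpref_total by blast
  ultimately show False using assms(6) wpref_trans by blast
qed

lemma meet_stable:
  assumes "stable_matching I M" "stable_matching I N"
  shows "stable_matching I (meet M N)"
  using meet_perfect[OF assms] meet_subset[of M N] meet_stable_aux[OF assms]
    meet_stable_aux[OF assms(2,1), unfolded meet_commute[of N M]]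
  unfolding stable_matching_iff[of I "meet M N"] by blast

text \<open>Each new \<open>M\<close> is compared with the current top \<open>P\<close>: their join
  becomes the new top, and their meet joins the matchings below. Only edges of the given family are
  used, which keeps everything disjoint.\<close>

lemma disjoint_family_peel:
  assumes "finite T" "T \<noteq> {}" "disjoint_stable_family I T"
  shows "\<exists>P T'. stable_matching I P \<and> disjoint_stable_family I T' \<and> finite T' \<and>
     card T = Suc (card T') \<and> P \<union> \<Union>T' \<subseteq> \<Union>T \<and>
     (\<forall>m w w'. (m, w) \<in> P \<longrightarrow> (m, w') \<in> \<Union>T' \<longrightarrow> mpref m w w')"
  using assms
proof (induction T rule: finite_ne_induct)
  case (singleton M)
  then show ?case
    by (intro exI[of _ M] exI[of _ "{}"]) (auto simp: disjoint_stable_family_def)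
next
  case (insert M T)
  have dT: "disjoint_stable_family I T" and M: "stable_matching I M"
    using insert.prems unfolding disjoint_stable_family_def by (auto simp: pairwise_insert)
  have MT: "M \<inter> N = {}" if "N \<in> T" for N
    using insert.prems insert.hyps(3) that
    unfolding disjoint_stable_family_def by (auto simp: pairwise_insert disjnt_def)
  obtain P T' where P: "stable_matching I P" "disjoint_stable_family I T'" "finite T'"
      "card T = Suc (card T')" "P \<union> \<Union>T' \<subseteq> \<Union>T"
      and above: "\<And>m w w'. (m, w) \<in> P \<Longrightarrow> (m, w') \<in> \<Union>T' \<Longrightarrow> mpref m w w'"
    using insert.IH[OF dT] by blast
  note pP = stable_perfect[OF P(1)] and pM = stable_perfect[OF M]
  have "M \<inter> \<Union>T = {}" using MT by blast
  then have PM: "P \<inter> M = {}" and MT': "M \<inter> \<Union>T' = {}" using P(5) by blast+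
  have "P \<inter> \<Union>T' = {}" using above mpref_irrefl by fastforce
  then have dis: "meet P M \<inter> \<Union>T' = {}" using MT' meet_subset[of P M] by blast
  have st: "stable_matching I (join P M)" "stable_matching I (meet P M)"
    using join_stable meet_stable P(1) M by blast+
  \<comment> \<open>A nonempty matching disjoint from all members of \<open>T'\<close> is not one of
    them, so no matching is lost in the count.\<close>
  obtain e where "e \<in> meet P M"
    using perfect_partner[OF stable_perfect[OF st(2)]] by blast
  then have new: "meet P M \<notin> T'" using dis by blast
  have "disjoint_stable_family I (insert (meet P M) T')"
    using P(2) st(2) dis unfolding disjoint_stable_family_def
    by (auto simp: pairwise_insert disjnt_def)
  moreover have "mpref m w w'" if "(m, w) \<in> join P M" "(m, w') \<in> \<Union>(insert (meet P M) T')" for m w w'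
  proof (cases "(m, w') \<in> meet P M")
    case True
    then have "w' = w \<or> mpref m w w'" using join_ge[OF that(1)] meet_subset by blast
    \<comment> \<open>A partner common to join and meet would be an edge of both \<open>P\<close>
      and \<open>M\<close>, which are disjoint; this makes the comparison strict.\<close>
    moreover have "w' \<noteq> w" using join_meet_eq[OF pP pM] that(1) True PM by blast
    ultimately show ?thesis by blast
  next
    case False
    then have w': "(m, w') \<in> \<Union>T'" using that(2) by blast
    obtain x where x: "(m, x) \<in> P" using perfect_partner[OF pP] .
    then have "mpref m x w'" using above w' by blast
    moreover have "x = w \<or> mpref m w x" using join_ge[OF that(1)] x by blast
    ultimately show ?thesis using mpref_trans by blast
  qed
  moreover have "card (insert M T) = Suc (card (insert (meet P M) T'))"
    using insert.hyps(1,3) P(3,4) new by simp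
  moreover have "join P M \<union> \<Union>(insert (meet P M) T') \<subseteq> \<Union>(insert M T)"
    using P(5) join_subset[of P M] meet_subset[of P M] by blast
  ultimately show ?case using st(1) P(3) by blast
qed

text \<open>Each man likes his partner in \<open>X\<close> at least as much as the one in the peeled
  matching \<open>P\<close>, and strictly prefers the latter to all partners in \<open>T'\<close>.
  So \<open>T'\<close> avoids \<open>X\<close>, at the price of the single matching
  \<open>P\<close>.\<close>

lemma disjoint_stable_family_below:
  assumes "gs_ext_inv A X" "Domain X = UNIV" "disjoint_stable_family I T" "\<Union>T \<subseteq> A"
  obtains T' where "disjoint_stable_family I T'" "\<Union>T' \<subseteq> A - X" "card T \<le> Suc (card T')"
proof (cases "T = {}")
  case True
  then show ?thesis using that[of "{}"] assms(3) by simp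
next
  case False
  obtain P T' where P: "stable_matching I P" "disjoint_stable_family I T'"
      "card T = Suc (card T')" "P \<union> \<Union>T' \<subseteq> \<Union>T"
      and above: "\<And>m w w'. (m, w) \<in> P \<Longrightarrow> (m, w') \<in> \<Union>T' \<Longrightarrow> mpref m w w'"
    using disjoint_family_peel[OF _ False assms(3)] by auto
  have "(m, w) \<notin> X" if "(m, w) \<in> \<Union>T'" for m w
  proof
    assume X: "(m, w) \<in> X"
    obtain x where x: "(m, x) \<in> P" using perfect_partner[OF stable_perfect[OF P(1)]] .
    then have "mpref m x w" using above that by blast
    moreover have "x = w \<or> mpref m w x"
      using gs_ext_invD(3)[OF assms(1) X] x P(4) assms(4) by blast
    ultimately show False using mpref_asym mpref_irrefl by blast
  qed
  moreover have "\<Union>T' \<subseteq> A" using P(4) assms(4) by (meson le_sup_iff order_trans)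
  ultimately have "\<Union>T' \<subseteq> A - X" by auto
  then show ?thesis using that P(2,3) by simp
qed

section \<open>The loop\<close>

text \<open>The bound is kept as a sum so that it passes through the rounds: a round adds one
  matching to \<open>S\<close> and costs the competing family \<open>T\<close> at most one.
  Disjointness of \<open>\<Union>S\<close> from \<open>A\<close> makes each \<open>X\<close>
  new.\<close>

lemma dsm_loop_correct:
  assumes "dsm_loop Z L X S R" "man_pessimal I Z" "L = restrict_lists I A"
    "gs_ext_inv A X" "Domain X = UNIV" "Z \<subseteq> A"
    "disjoint_stable_family I S" "\<Union>S \<inter> A = {}"
  shows "disjoint_stable_family I R \<and>
    (\<forall>T. disjoint_stable_family I T \<longrightarrow> \<Union>T \<subseteq> A \<longrightarrow> card T + card S \<le> card R)"
  using assms
proof (induction arbitrary: A rule: dsm_loop.induct)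
  case (stop X L S)
  then have Z: "stable_matching I Z" by (simp add: man_pessimal_def)
  have dZ: "Z \<inter> \<Union>S = {}" using stop.prems by blast
  obtain m w where mw: "(m, w) \<in> X" "(m, w) \<in> Z" using stop.hyps by fastforce
  have "Z \<notin> S" using dZ mw by blast
  then have cS: "card (insert Z S) = Suc (card S)" by simp
  have "card T \<le> 1" if T: "disjoint_stable_family I T" "\<Union>T \<subseteq> A" for T
  proof -
    \<comment> \<open>For \<open>m\<close>, the partner \<open>w\<close> is best within
      \<open>A\<close> because of \<open>X\<close> and worst among stable partners because of
      \<open>Z\<close>, so every member of \<open>T\<close> contains \<open>(m, w)\<close>.\<close>
    have "(m, w) \<in> M" if "M \<in> T" for M
    proof -
      have M: "stable_matching I M" using T(1) that by (simp add: disjoint_stable_family_def)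
      obtain x where x: "(m, x) \<in> M" using perfect_partner[OF stable_perfect[OF M]] .
      have "x = w \<or> mpref m w x"
        using gs_ext_invD(3)[OF stop.prems(3) mw(1)] x T(2) that by blast
      moreover have "x = w \<or> mpref m x w"
        using stop.prems(1) M mw(2) x unfolding man_pessimal_def by blast
      ultimately show ?thesis using x mpref_asym by blast
    qed
    then have "M = N" if "M \<in> T" "N \<in> T" for M N
      using that T(1) unfolding disjoint_stable_family_def pairwise_def disjnt_def by blast
    then show ?thesis by (simp add: card_le_Suc0_iff_eq)
  qed
  moreover have "disjoint_stable_family I (insert Z S)"
    using stop.prems(6) Z dZ unfolding disjoint_stable_family_def
    by (auto simp: pairwise_insert disjnt_def)
  ultimately show ?case using cS by fastforce
next
  case (continue X L L' L'' X' S R)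
  note invX = continue.prems(3) and dom = continue.prems(4)
  have L': "L' = restrict_lists I (A - X)"
    using continue.hyps(2) trim_restrict[OF invX dom] continue.prems(2) by simp
  obtain A' where A': "A' \<subseteq> A - X" "L'' = restrict_lists I A'" "gs_ext_inv A' X'" "Domain X' = UNIV"
      and keep: "\<And>M. stable_matching I M \<Longrightarrow> M \<subseteq> A - X \<Longrightarrow> M \<subseteq> A'"
    using gs_extendedD[OF continue.hyps(3)[unfolded L'] gs_ext_inv_remove[OF invX dom]] by metis
  have X: "stable_matching I X" using gs_ext_inv_stable[OF invX dom] .
  \<comment> \<open>The loop continues only if \<open>X\<close> misses \<open>Z\<close>, so
    \<open>Z\<close> lies in \<open>A - X\<close> and survives the next run.\<close>
  have "Z \<subseteq> A'"
    using keep continue.prems(1,5) continue.hyps(1) unfolding man_pessimal_def by blast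
  moreover have XA: "X \<subseteq> A" using gs_ext_invD(2)[OF invX] .
  then have XS: "X \<inter> \<Union>S = {}" using continue.prems(7) by blast
  then have dXS: "disjoint_stable_family I (insert X S)"
    using continue.prems(6) X unfolding disjoint_stable_family_def
    by (auto simp: pairwise_insert disjnt_def)
  moreover have "\<Union>(insert X S) \<inter> A' = {}" using A'(1) continue.prems(7) by blast
  ultimately have IH: "disjoint_stable_family I R"
    "\<And>T. disjoint_stable_family I T \<Longrightarrow> \<Union>T \<subseteq> A' \<Longrightarrow> card T + card (insert X S) \<le> card R"
    using continue.IH[OF continue.prems(1) A'(2-4)] by blast+
  obtain e where "e \<in> X" using dom by blast
  then have "X \<notin> S" using XS by blast
  then have cS: "card (insert X S) = Suc (card S)" by simp
  have "card T + card S \<le> card R" if T: "disjoint_stable_family I T" "\<Union>T \<subseteq> A" for T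
  proof -
    obtain T' where T': "disjoint_stable_family I T'" "\<Union>T' \<subseteq> A - X" "card T \<le> Suc (card T')"
      using disjoint_stable_family_below[OF invX dom T] .
    have "\<Union>T' \<subseteq> A'"
      using T'(1,2) keep unfolding disjoint_stable_family_def by (meson Sup_le_iff)
    then show ?thesis using IH(2)[OF T'(1)] T'(3) cS by linarith
  qed
  then show ?case using IH(1) by blast
qed

section \<open>Existence of terminating runs, and correctness of the whole algorithm\<close>

lemma gs_extended_exists:
  assumes "gs_ext_inv A {}" "stable_matching I M" "M \<subseteq> A"
  shows "\<exists>L' X. gs_extended (restrict_lists I A) L' X"
  using gs_ext_terminates[OF assms] unfolding gs_extended_def .

text \<open>Each round removes the nonempty \<open>X\<close> from \<open>A\<close>, so the rounds
  are finitely many; the surviving \<open>Z\<close> guarantees that every call of GS-Extended can be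
  completed.\<close>

lemma dsm_loop_exists:
  assumes "stable_matching I Z" "gs_ext_inv A X" "Domain X = UNIV" "Z \<subseteq> A"
  shows "\<exists>R. dsm_loop Z (restrict_lists I A) X S R"
  using assms
proof (induction "card A" arbitrary: A X S rule: less_induct)
  case less
  show ?case
  proof (cases "X \<inter> Z = {}")
    case True
    note inv' = gs_ext_inv_remove[OF less.prems(2,3)]
    have ZAX: "Z \<subseteq> A - X" using True less.prems(4) by blast
    obtain L' X' where gs: "gs_extended (restrict_lists I (A - X)) L' X'"
      using gs_extended_exists[OF inv' less.prems(1) ZAX] by blast
    obtain A' where A': "A' \<subseteq> A - X" "L' = restrict_lists I A'" "gs_ext_inv A' X'" "Domain X' = UNIV"
        "Z \<subseteq> A'"
      using gs_extendedD[OF gs inv'] less.prems(1) ZAX by metis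
    obtain e where "e \<in> X" using less.prems(3) by blast
    then have "A' \<subset> A" using A'(1) gs_ext_invD(2)[OF less.prems(2)] by blast
    then have "card A' < card A" by (intro psubset_card_mono) auto
    then obtain R where "dsm_loop Z (restrict_lists I A') X' (insert X S) R"
      using less.hyps less.prems(1) A'(3-5) by blast
    then show ?thesis
      using dsm_loop.continue[OF True _ gs] trim_restrict[OF less.prems(2,3)] A'(2) by blast
  qed (blast intro: dsm_loop.stop)
qed

lemma gs_ext_inv_UNIV: "gs_ext_inv UNIV {}"
  by (simp add: gs_ext_inv_def)

lemma dsm_correct:
  assumes "gs_extended I L X" "man_pessimal I Z" "dsm_loop Z L X {} R"
  shows "disjoint_stable_family I R \<and>
    (\<forall>T. disjoint_stable_family I T \<longrightarrow> card T \<le> card R)"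
proof -
  have stZ: "stable_matching I Z" using assms(2) by (simp add: man_pessimal_def)
  have gs: "gs_extended (restrict_lists I UNIV) L X" using assms(1) by (simp add: restrict_lists_UNIV)
  obtain A where A: "L = restrict_lists I A" "gs_ext_inv A X" "Domain X = UNIV"
      and keep: "\<And>M. stable_matching I M \<Longrightarrow> M \<subseteq> UNIV \<Longrightarrow> M \<subseteq> A"
    using gs_extendedD[OF gs gs_ext_inv_UNIV] by metis
  have "disjoint_stable_family I {}" by (simp add: disjoint_stable_family_def)
  then have "disjoint_stable_family I R"
    and "\<And>T. disjoint_stable_family I T \<Longrightarrow> \<Union>T \<subseteq> A \<Longrightarrow> card T \<le> card R"
    using dsm_loop_correct[OF assms(3,2) A] keep[OF stZ] by auto
  \<comment> \<open>The first run deletes no edge of a stable matching, so the bound relative to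
    \<open>A\<close> covers all families.\<close>
  moreover have "\<Union>T \<subseteq> A" if "disjoint_stable_family I T" for T
    using that keep unfolding disjoint_stable_family_def by blast
  ultimately show ?thesis by blast
qed

lemma dsm_exists:
  assumes "stable_matching I Z"
  shows "\<exists>L X R. gs_extended I L X \<and> dsm_loop Z L X {} R"
proof -
  obtain L X where gs: "gs_extended (restrict_lists I UNIV) L X"
    using gs_extended_exists[OF gs_ext_inv_UNIV assms] by blast
  obtain A where A: "L = restrict_lists I A" "gs_ext_inv A X" "Domain X = UNIV" "Z \<subseteq> A"
    using gs_extendedD[OF gs gs_ext_inv_UNIV] assms by (metis subset_UNIV)
  obtain R where "dsm_loop Z (restrict_lists I A) X {} R"
    using dsm_loop_exists[OF assms A(2-4)] by blast
  then show ?thesis using gs A(1) by (metis restrict_lists_UNIV)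
qed

section \<open>The Gale-Shapley algorithm\<close>

text \<open>Here \<open>'m\<close> is the proposing side; the woman-proposing run is obtained by swapping the lists.\<close>

definition gs_inv :: "('m \<times> 'w) set \<Rightarrow> ('m \<times> 'w) set \<Rightarrow> bool" where
  "gs_inv Q E \<longleftrightarrow> E \<subseteq> Q \<and>
     (\<forall>m m' w. (m, w) \<in> E \<longrightarrow> (m', w) \<in> E \<longrightarrow> m = m') \<and>
     (\<forall>m w w'. (m, w) \<in> Q \<longrightarrow> mpref m w' w \<longrightarrow> (m, w') \<in> Q) \<and>
     (\<forall>m w w'. (m, w) \<in> E \<longrightarrow> (m, w') \<in> Q \<longrightarrow> w' = w \<or> mpref m w' w) \<and>
     (\<forall>m w. (m, w) \<in> Q \<longrightarrow> (\<exists>m'. (m', w) \<in> E \<and> (m' = m \<or> wpref w m' m))) \<and>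
     (\<forall>M m w. stable_matching I M \<longrightarrow> (m, w) \<in> M \<longrightarrow> (m, w) \<in> Q \<longrightarrow> (m, w) \<in> E)"

text \<open>The third and fifth facts yield stability of the final matching. The last one, that no
  stable pair is ever rejected, is the classical source of proposer-optimality.\<close>

lemma gs_invD:
  assumes "gs_inv Q E"
  shows "E \<subseteq> Q" "(m, w) \<in> E \<Longrightarrow> (m', w) \<in> E \<Longrightarrow> m = m'"
    "(m, w) \<in> Q \<Longrightarrow> mpref m w' w \<Longrightarrow> (m, w') \<in> Q"
    "(m, w) \<in> E \<Longrightarrow> (m, w') \<in> Q \<Longrightarrow> w' = w \<or> mpref m w' w"
    "(m, w) \<in> Q \<Longrightarrow> \<exists>m'. (m', w) \<in> E \<and> (m' = m \<or> wpref w m' m)"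
    "stable_matching I M \<Longrightarrow> (m, w) \<in> M \<Longrightarrow> (m, w) \<in> Q \<Longrightarrow> (m, w) \<in> E"
  using assms unfolding gs_inv_def by blast+

lemma gs_inv_fun: "gs_inv Q E \<Longrightarrow> (m, w) \<in> E \<Longrightarrow> (m, w') \<in> E \<Longrightarrow> w = w'"
  by (metis gs_invD(1,4) mpref_asym subsetD)

text \<open>Applied when \<open>w\<close> rejects \<open>p\<close> in favour of \<open>m\<close>: everyone \<open>m\<close> prefers to \<open>w\<close> has already rejected
  him, so the last premise is the invariant.\<close>

lemma gs_rejected_not_stable:
  assumes "stable_matching I M" "(p, w) \<in> M" "wpref w m p"
    "\<And>x. (m, x) \<in> M \<Longrightarrow> mpref m x w \<Longrightarrow> False"
  shows False
proof -
  note pM = stable_perfect[OF assms(1)]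
  obtain x where x: "(m, x) \<in> M" using perfect_partner[OF pM] .
  have "x \<noteq> w" using perfect_unique(2)[OF pM] x assms(2,3) wpref_irrefl by blast
  then have "mpref m w x" using assms(4)[OF x] mpref_total by blast
  then show False using not_blocked[OF assms(1,2) x assms(3)] by blast
qed

text \<open>Covers both kinds of acceptance: if \<open>w\<close> is free, the last premise is
  vacuous and the set comprehension is \<open>E\<close> itself.\<close>

lemma gs_inv_accept:
  assumes "gs_inv Q E" "m \<notin> Domain E" "(m, w) \<notin> Q"
    "\<And>x. (m, x) \<notin> Q \<Longrightarrow> x = w \<or> mpref m w x"
    "\<And>p. (p, w) \<in> E \<Longrightarrow> wpref w m p"
  shows "gs_inv (insert (m, w) Q) (insert (m, w) {(p, v) \<in> E. v \<noteq> w})"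
    (is "gs_inv ?Q ?E")
  unfolding gs_inv_def
proof (intro conjI allI impI)
  note inv = gs_invD[OF assms(1)]
  show "?E \<subseteq> ?Q" using inv(1) by blast
  show "a = b" if "(a, v) \<in> ?E" "(b, v) \<in> ?E" for a b v using that inv(2) by blast
  show "(a, u) \<in> ?Q" if "(a, v) \<in> ?Q" "mpref a u v" for a u v
    using that inv(3) assms(4) mpref_asym mpref_irrefl by blast
  show "u = v \<or> mpref a u v" if "(a, v) \<in> ?E" "(a, u) \<in> ?Q" for a u v
  proof (cases "a = m")
    case True
    then have "v = w" using that(1) assms(2) by blast
    moreover have "mpref m u w" if "(m, u) \<in> Q" "u \<noteq> w"
      using that inv(3)[OF that(1), of w] assms(3) mpref_total by blast
    ultimately show ?thesis using that(2) True by blast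
  qed (use that inv(4) in blast)
  show "\<exists>b. (b, v) \<in> ?E \<and> (b = a \<or> wpref v b a)" if av: "(a, v) \<in> ?Q" for a v
  proof (cases "v = w")
    case True
    show ?thesis
    proof (cases "a = m")
      case False
      then obtain b where "(b, w) \<in> E" "b = a \<or> wpref w b a" using inv(5) av True by blast
      then have "wpref w m a" using assms(5) wpref_trans by blast
      then show ?thesis using True by blast
    qed (use True in blast)
  qed (use inv(5) av in blast)
  show "(a, v) \<in> ?E" if M: "stable_matching I M" and av: "(a, v) \<in> M" "(a, v) \<in> ?Q" for M a v
  proof -
    \<comment> \<open>Only the displaced pair could violate the last clause. A partner in
      \<open>M\<close> whom \<open>m\<close> prefers to \<open>w\<close> would have been proposed to
      already and, as a stable partner, would still be engaged to \<open>m\<close>, who is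
      free.\<close>
    have False if p: "(p, w) \<in> M" "(p, w) \<in> E" for p
    proof (rule gs_rejected_not_stable[OF M p(1) assms(5)[OF p(2)]])
      fix x assume x: "(m, x) \<in> M" "mpref m x w"
      then have "(m, x) \<in> Q" using assms(4) mpref_asym mpref_irrefl by blast
      then show False using inv(6)[OF M x(1)] assms(2) by blast
    qed
    then show ?thesis using inv(6)[OF M av(1)] av by blast
  qed
qed

lemma gs_inv_reject:
  assumes "gs_inv Q E" "m \<notin> Domain E"
    "\<And>x. (m, x) \<notin> Q \<Longrightarrow> x = w \<or> mpref m w x"
    "(p, w) \<in> E" "wpref w p m"
  shows "gs_inv (insert (m, w) Q) E"
  unfolding gs_inv_def
proof (intro conjI allI impI)
  note inv = gs_invD[OF assms(1)]
  let ?Q = "insert (m, w) Q"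
  show "E \<subseteq> ?Q" using inv(1) by blast
  show "a = b" if "(a, v) \<in> E" "(b, v) \<in> E" for a b v using that inv(2) by blast
  show "(a, u) \<in> ?Q" if "(a, v) \<in> ?Q" "mpref a u v" for a u v
    using that inv(3) assms(3) mpref_asym mpref_irrefl by blast
  show "u = v \<or> mpref a u v" if "(a, v) \<in> E" "(a, u) \<in> ?Q" for a u v
    using that inv(4) assms(2) by blast
  show "\<exists>b. (b, v) \<in> E \<and> (b = a \<or> wpref v b a)" if "(a, v) \<in> ?Q" for a v
    using that inv(5) assms(4,5) by blast
  show "(a, v) \<in> E" if M: "stable_matching I M" and av: "(a, v) \<in> M" "(a, v) \<in> ?Q" for M a v
  proof -
    \<comment> \<open>Now \<open>p\<close> is the winner: a partner in \<open>M\<close> whom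
      \<open>p\<close> prefers to \<open>w\<close> would be engaged to him, but he is engaged to
      \<open>w\<close>.\<close>
    have "(m, w) \<notin> M"
    proof
      assume "(m, w) \<in> M"
      then show False
      proof (rule gs_rejected_not_stable[OF M _ assms(5)])
        fix x assume x: "(p, x) \<in> M" "mpref p x w"
        then have "(p, x) \<in> E" using inv(6)[OF M x(1)] inv(3) inv(1) assms(4) by blast
        then show False using gs_inv_fun[OF assms(1,4)] x(2) mpref_irrefl by blast
      qed
    qed
    then show ?thesis using inv(6)[OF M av(1)] av by blast
  qed
qed

section \<open>Gale-Shapley runs: invariance, progress, termination and optimality\<close>

lemma filter_not_proposed:
  assumes "filter (\<lambda>y. (m, y) \<notin> Q) (fst I m) = w # ws"
  shows "(m, w) \<notin> Q" "(m, x) \<notin> Q \<Longrightarrow> x = w \<or> mpref m w x"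
proof -
  have "w \<in> set (filter (\<lambda>y. (m, y) \<notin> Q) (fst I m))" unfolding assms by simp
  then show "(m, w) \<notin> Q" by simp
  show "(m, x) \<notin> Q \<Longrightarrow> x = w \<or> mpref m w x"
    using filter_eq_Cons_prefers[OF assms] inst_lists by auto
qed

lemma gs_step_inv:
  assumes "gs_step I (Q, E) (Q', E')" "gs_inv Q E"
  shows "gs_inv Q' E'" "Q \<subset> Q'"
proof -
  note inv = gs_invD[OF assms(2)]
  from assms(1) have "gs_inv Q' E' \<and> Q \<subset> Q'"
  proof cases
    case (accept_free m w ws)
    note f = filter_not_proposed[OF accept_free(4)]
    have "{(p, v) \<in> E. v \<noteq> w} = E" using accept_free(5) by auto
    then show ?thesis
      using gs_inv_accept[OF assms(2) accept_free(3) f] accept_free f(1) by auto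
  next
    case (accept_better m w ws p)
    note f = filter_not_proposed[OF accept_better(4)]
    have "{(p, v) \<in> E. v \<noteq> w} = E - {(p, w)}" using inv(2) accept_better(5) by auto
    moreover have "wpref w m q" if "(q, w) \<in> E" for q using that inv(2) accept_better(5,6) by blast
    ultimately show ?thesis
      using gs_inv_accept[OF assms(2) accept_better(3) f] accept_better f(1) by auto
  next
    case (reject m w ws p)
    note f = filter_not_proposed[OF reject(4)]
    \<comment> \<open>The engaged \<open>p\<close> is not the free \<open>m\<close>, so totality
      turns the failed preference around.\<close>
    have "wpref w p m" using reject(3,5,6) wpref_total[of p m w] by blast
    then show ?thesis
      using gs_inv_reject[OF assms(2) reject(3) f(2) reject(5)] reject f(1) by auto
  qed
  then show "gs_inv Q' E'" "Q \<subset> Q'" by auto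
qed

lemma gs_run_inv:
  assumes "(gs_step I)\<^sup>*\<^sup>* ({}, {}) (Q, E)"
  shows "gs_inv Q E"
  using assms
proof (induction rule: rtranclp_induct2)
  case refl
  show ?case by (simp add: gs_inv_def)
qed (rule gs_step_inv(1))

lemma gs_progress:
  assumes "gs_inv Q E" "Domain E \<noteq> UNIV"
  shows "\<exists>Q' E'. gs_step I (Q, E) (Q', E')"
proof -
  obtain m where m: "m \<notin> Domain E" using assms(2) by blast
  \<comment> \<open>If all women were engaged, counting would engage all men, including
    \<open>m\<close>.\<close>
  have "Range E \<noteq> UNIV"
  proof
    assume "Range E = UNIV"
    then have "perfect_matching (E\<inverse>)"
    proof (intro perfect_matching_if_inj card_eq[symmetric])
      show "Domain (E\<inverse>) = UNIV" using \<open>Range E = UNIV\<close> by simp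
      show "m = m'" if "(w, m) \<in> E\<inverse>" "(w, m') \<in> E\<inverse>" for w m m'
        using gs_invD(2)[OF assms(1)] that by blast
      show "w = w'" if "(w, m) \<in> E\<inverse>" "(w', m) \<in> E\<inverse>" for w w' m
        using gs_inv_fun[OF assms(1)] that by blast
    qed
    then have "perfect_matching E" by (simp only: perfect_matching_converse)
    then obtain w where "(m, w) \<in> E" by (rule perfect_partner)
    then show False using m by blast
  qed
  \<comment> \<open>A woman who has received a proposal is engaged, so a free woman has not been
    asked by \<open>m\<close>, and his list is not exhausted.\<close>
  then obtain v where "(m, v) \<notin> Q" using gs_invD(5)[OF assms(1)] by blast
  then have "v \<in> set (filter (\<lambda>y. (m, y) \<notin> Q) (fst I m))" by (simp add: inst_lists)
  then obtain w ws where w: "filter (\<lambda>y. (m, y) \<notin> Q) (fst I m) = w # ws"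
    by (metis list.set_cases)
  show ?thesis using gs_step.intros[OF m w] by blast
qed

lemma gs_terminates:
  assumes "gs_inv Q E"
  shows "\<exists>Q' E'. (gs_step I)\<^sup>*\<^sup>* (Q, E) (Q', E') \<and> Domain E' = UNIV"
  using assms
proof (induction "card (- Q)" arbitrary: Q E rule: less_induct)
  case less
  show ?case
  proof (cases "Domain E = UNIV")
    case False
    then obtain Q1 E1 where s: "gs_step I (Q, E) (Q1, E1)"
      using gs_progress[OF less.prems] by blast
    note inv = gs_step_inv[OF s less.prems]
    have "card (- Q1) < card (- Q)" using inv(2) by (intro psubset_card_mono) auto
    then show ?thesis
      using less.hyps inv(1) s by (meson converse_rtranclp_into_rtranclp)
  qed blast
qed

lemma gale_shapley_exists: "\<exists>E. gale_shapley I E"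
proof -
  have "gs_inv {} {}" by (simp add: gs_inv_def)
  then obtain Q E where "(gs_step I)\<^sup>*\<^sup>* ({}, {}) (Q, E)" "Domain E = UNIV"
    using gs_terminates by blast
  then show ?thesis unfolding gale_shapley_def by blast
qed

text \<open>If \<open>m\<close> preferred \<open>w'\<close> to his final partner, he would have
  proposed to \<open>w'\<close> earlier; being a stable pair, they could not have been
  separated.\<close>

lemma gale_shapley_proposer_optimal:
  assumes "gale_shapley I E"
  shows "stable_matching I E"
    and "stable_matching I M \<Longrightarrow> (m, w) \<in> E \<Longrightarrow> (m, w') \<in> M \<Longrightarrow> w' = w \<or> mpref m w w'"
proof -
  obtain Q where inv: "gs_inv Q E" and dom: "Domain E = UNIV"
    using assms gs_run_inv unfolding gale_shapley_def by blast
  have "perfect_matching E"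
    using card_eq dom gs_inv_fun[OF inv] gs_invD(2)[OF inv] by (rule perfect_matching_if_inj)
  moreover have False if "(m', w) \<in> E" "(m, w') \<in> E" "wpref w m m'" "mpref m w w'" for m w m' w'
  proof -
    have "(m, w) \<in> Q" using gs_invD(1,3)[OF inv] that(2,4) by blast
    then obtain a where "(a, w) \<in> E" "a = m \<or> wpref w a m" using gs_invD(5)[OF inv] by blast
    then show False using gs_invD(2)[OF inv that(1)] that(3) wpref_asym wpref_irrefl by blast
  qed
  ultimately show "stable_matching I E" unfolding stable_matching_iff by blast
  show "w' = w \<or> mpref m w w'" if "stable_matching I M" "(m, w) \<in> E" "(m, w') \<in> M"
  proof (rule ccontr)
    assume "\<not> (w' = w \<or> mpref m w w')"
    then have ne: "w' \<noteq> w" and "mpref m w' w" using mpref_total by blast+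
    then have "(m, w') \<in> Q" using gs_invD(1,3)[OF inv] that(2) by blast
    then show False
      using gs_invD(6)[OF inv that(1,3)] gs_inv_fun[OF inv that(2)] ne by blast
  qed
qed

end

section \<open>Exchanging the sides, and the final result\<close>

lemma sm_instance_swap: "sm_instance I \<Longrightarrow> sm_instance (snd I, fst I)"
  by (simp add: sm_instance_def)

lemma woman_proposing_gs_exists:
  fixes I :: "('m::finite, 'w::finite) pref_lists"
  assumes "sm_instance I"
  shows "\<exists>Z. woman_proposing_gs I Z"
proof -
  obtain E where "gale_shapley (snd I, fst I) E"
    using gale_shapley_exists[OF sm_instance_swap[OF assms]] by blast
  then have "woman_proposing_gs I (E\<inverse>)" by (simp add: woman_proposing_gs_def)
  then show ?thesis by blast
qed

text \<open>If \<open>m\<close> did worse in a stable \<open>M\<close> than with \<open>w\<close>,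
  his partner in \<open>Z\<close>, then \<open>w\<close>, who has her best stable partner in
  \<open>Z\<close>, would prefer him to her partner in \<open>M\<close>, and the two would block
  \<open>M\<close>.\<close>

lemma woman_proposing_gs_man_pessimal:
  fixes I :: "('m::finite, 'w::finite) pref_lists"
  assumes I: "sm_instance I" and Z: "woman_proposing_gs I Z"
  shows "man_pessimal I Z"
proof -
  note opt = gale_shapley_proposer_optimal[OF sm_instance_swap[OF I] Z[unfolded woman_proposing_gs_def]]
  have stZ: "stable_matching I Z" using opt(1) by (simp only: stable_matching_converse)
  have "w' = w \<or> prefers (fst I m) w' w"
    if M: "stable_matching I M" and mw: "(m, w) \<in> Z" "(m, w') \<in> M" for M m w w'
  proof (rule ccontr)
    assume "\<not> (w' = w \<or> prefers (fst I m) w' w)"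
    then have ne: "w' \<noteq> w" and better: "prefers (fst I m) w w'"
      using mpref_total[OF I] by blast+
    obtain p where p: "(p, w) \<in> M" using perfect_partner'[OF stable_perfect[OF M]] .
    have "p \<noteq> m" using p mw(2) ne perfect_unique(1)[OF stable_perfect[OF M]] by blast
    moreover have "stable_matching (snd I, fst I) (M\<inverse>)" using M by (simp only: stable_matching_converse)
    ultimately have "prefers (snd I w) m p" using opt(2)[of "M\<inverse>" w m p] mw(1) p by simp
    then show False using not_blocked[OF M p mw(2)] better by blast
  qed
  then show ?thesis using stZ unfolding man_pessimal_def by blast
qed

text \<open>Since the algorithm is a relation, the claim about all its outputs is accompanied by the
  existence of one, which excludes vacuity.\<close>

theorem theorem10:
  fixes I :: "('m::finite, 'w::finite) pref_lists"
  assumes "sm_instance I"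
  shows "(\<exists>S. dsm_output I S) \<and>
         (\<forall>S. dsm_output I S \<longrightarrow>
            disjoint_stable_family I S \<and>
            (\<forall>T. disjoint_stable_family I T \<longrightarrow> card T \<le> card S))"
proof (intro conjI allI impI)
  note pess = woman_proposing_gs_man_pessimal[OF assms]
  obtain Z where Z: "woman_proposing_gs I Z"
    using woman_proposing_gs_exists[OF assms] by blast
  then have "stable_matching I Z" using pess man_pessimal_def by blast
  then show "\<exists>S. dsm_output I S"
    using dsm_exists[OF assms] Z unfolding dsm_output_def by metis
  fix S assume "dsm_output I S"
  then obtain Z L X where "woman_proposing_gs I Z" "gs_extended I L X" "dsm_loop Z L X {} S"
    unfolding dsm_output_def by blast
  then have *: "disjoint_stable_family I S \<and>
      (\<forall>T. disjoint_stable_family I T \<longrightarrow> card T \<le> card S)"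
    using dsm_correct[OF assms] pess by blast
  then show "disjoint_stable_family I S" by blast
  show "card T \<le> card S" if "disjoint_stable_family I T" for T using * that by blast
qed

end
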